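(* Let $$R(x,y;q)=\sum_{n\ge 0}\left(\sum_{k\ge 0}\ \sum_{\pi\in\mathcal R_{n,k}} q^{\mathcal F_\pi}y^k\right)\frac{x^n}{n!}$$ be the generating function, exponential in the length $n$, of restricted growth sequences, where $y$ marks the maximal letter $k$ and $q$ marks the number of fixed points. Then $$R(x,y;q)=e^{y(e^x-1)}+\int_0^x (q-1)\,y\,e^{x-t+(1+qt)ye^{x-t}-y}\,dt .$$
   Context: A restricted growth sequence of length $n\ge 1$ is a sequence $\pi=\pi_1\pi_2\cdots\pi_n$ of positive integers with $\pi_1=1$ and $\pi_{j+1}\le 1+\max\{\pi_1,\dots,\pi_j\}$ for all $1\le j<n$. The set $\mathcal R_{n,k}$ consists of all restricted growth sequences of length $n$ with maximal letter $k$. An index $i\in\{1,\dots,n\}$ is a fixed point of $\pi$ if $\pi_i=i$, and $\mathcal F_\pi$ denotes the number of fixed points of $\pi$. The null (empty) sequence is the unique sequence of length $0$; it is counted with $k=0$ and zero fixed points, so it contributes $1$ to $R$. For $n\ge 1$, $\mathcal R_{n,0}=\emptyset$. Equivalently, with $Q_0(x;q)=1$, $Q_k(x;q)=\sum_{n\ge k}\sum_{\pi\in\mathcal R_{n,k}}x^nq^{\mathcal F_\pi}$ for $k\ge 1$, and $Q(x,y;q)=\sum_{k\ge 0}Q_k(x;q)y^k$, one has $R(x,y;q)=\sum_{n\ge 0}\big([x^n]Q(x,y;q)\big)\frac{x^n}{n!}$, where $[x^n]$ extracts the coefficient of $x^n$. Generating functions may be read as formal power series in $x$ whose coefficients are polynomials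 in $y$ and $q$; the integral is the corresponding formal integral in $t$. *)

theory Defs
  imports "HOL-Computational_Algebra.Formal_Power_Series"
begin

unbundle fps_syntax

text \<open>
  A sequence is a list of natural numbers. Lists are indexed from 0, so the letter written
  \<open>\<pi>\<^sub>i\<close> for \<open>1 \<le> i \<le> n\<close> is \<open>\<pi> ! (i - 1)\<close>, and the letters preceding \<open>\<pi> ! j\<close> are those of
  \<open>take j \<pi>\<close>.
\<close>

definition restricted_growth :: "nat list \<Rightarrow> bool" where
  "restricted_growth \<pi> \<longleftrightarrow>
     \<pi> \<noteq> [] \<and> (\<forall>a\<in>set \<pi>. 0 < a) \<and> \<pi> ! 0 = 1 \<and>
     (\<forall>j. 1 \<le> j \<and> j < length \<pi> \<longrightarrow> \<pi> ! j \<le> 1 + Max (set (take j \<pi>)))"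

text \<open>The empty sequence is the only one of length 0 and is counted with maximal letter 0.\<close>

definition RGS :: "nat \<Rightarrow> nat \<Rightarrow> nat list set" where
  "RGS n k =
     (if n = 0 then (if k = 0 then {[]} else {})
      else {\<pi>. length \<pi> = n \<and> restricted_growth \<pi> \<and> Max (set \<pi>) = k})"

definition num_fixed_points :: "nat list \<Rightarrow> nat" where
  "num_fixed_points \<pi> = card {i \<in> {1..length \<pi>}. \<pi> ! (i - 1) = i}"

lemma restricted_growth_nth_le:
  assumes "restricted_growth \<pi>" "j < length \<pi>"
  shows "\<pi> ! j \<le> Suc j"
  using assms(2)
proof (induction j rule: less_induct)
  case (less j)
  show ?case
  proof (cases "j = 0")
    case True
    then show ?thesis using assms(1) by (simp add: restricted_growth_def)
  next
    case False
    have "\<pi> ! j \<le> 1 + Max (set (take j \<pi>))"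
      using assms(1) less.prems False by (simp add: restricted_growth_def)
    moreover have "Max (set (take j \<pi>)) \<le> j"
    proof (rule Max.boundedI)
      show "set (take j \<pi>) \<noteq> {}" using False less.prems by auto
      fix a assume "a \<in> set (take j \<pi>)"
      then obtain i where "i < j" "i < length \<pi>" "a = \<pi> ! i"
        by (auto simp: in_set_conv_nth)
      then show "a \<le> j" using less.IH[of i] by simp
    qed simp
    ultimately show ?thesis by simp
  qed
qed

lemma RGS_eq_empty:
  assumes "n < k"
  shows "RGS n k = {}"
proof -
  have le: "Max (set \<pi>) \<le> length \<pi>" if "restricted_growth \<pi>" for \<pi>
  proof (rule Max.boundedI)
    show "set \<pi> \<noteq> {}" using that by (simp add: restricted_growth_def)
    fix a assume "a \<in> set \<pi>"
    then obtain i where "i < length \<pi>" "a = \<pi> ! i" by (auto simp: in_set_conv_nth)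
    then show "a \<le> length \<pi>" using restricted_growth_nth_le[OF that, of i] by simp
  qed simp
  have False if "\<pi> \<in> RGS n k" for \<pi>
    using that le[of \<pi>] assms by (auto simp: RGS_def split: if_splits)
  then show ?thesis by blast
qed

lemma finite_RGS: "finite (RGS n k)"
proof -
  have "RGS n k \<subseteq> {\<pi>. set \<pi> \<subseteq> {..n} \<and> length \<pi> = n}"
    using restricted_growth_nth_le
    by (fastforce simp: RGS_def in_set_conv_nth split: if_splits)
  then show ?thesis
    by (rule finite_subset) (simp add: finite_lists_length_eq)
qed

text \<open>
  The generating function, exponential in the length, as a formal power series in \<open>x\<close>. The
  marks \<open>y\<close> and \<open>q\<close> range over an arbitrary field of characteristic 0; the choice
  \<open>rat poly poly fract\<close> with \<open>y\<close> and \<open>q\<close> the two polynomial variables makes them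
  indeterminates. By \<open>RGS_eq_empty\<close>, the sum over all \<open>k\<close> is the sum over \<open>k \<le> n\<close>.
\<close>

definition RGS_egf :: "'a::field_char_0 \<Rightarrow> 'a \<Rightarrow> 'a fps" where
  "RGS_egf y q =
     Abs_fps (\<lambda>n. (\<Sum>k\<le>n. \<Sum>\<pi>\<in>RGS n k. q ^ num_fixed_points \<pi> * y ^ k) / fact n)"

text \<open>
  A power series in \<open>t\<close> and \<open>x\<close> is a power series in \<open>t\<close> (the outer variable) whose coefficients
  are power series in \<open>x\<close>: the coefficient of \<open>t\<^sup>m x\<^sup>n\<close> in \<open>F\<close> is \<open>F $ m $ n\<close>.
\<close>

abbreviation const2 :: "'a::field_char_0 \<Rightarrow> 'a fps fps" where
  "const2 c \<equiv> fps_const (fps_const c)"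

abbreviation var_t :: "'a::field_char_0 fps fps" where
  "var_t \<equiv> fps_X"

abbreviation var_x :: "'a::field_char_0 fps fps" where
  "var_x \<equiv> fps_const fps_X"

text \<open>
  The exponential \<open>\<Sum>k. F\<^sup>k / k!\<close> of a series \<open>F\<close> with zero constant term (the only case in which
  it is meaningful). Every monomial of \<open>F\<^sup>k\<close> then has total degree at least \<open>k\<close>, so that only
  the terms with \<open>k \<le> m + n\<close> contribute to the coefficient of \<open>t\<^sup>m x\<^sup>n\<close>. The library's
  composition \<open>fps_exp 1 oo F\<close> is not available here: it would require \<open>F $ 0 = 0\<close>, that is, a
  series divisible by \<open>t\<close>.
\<close>

definition exp2 :: "'a::field_char_0 fps fps \<Rightarrow> 'a fps fps" where
  "exp2 F = Abs_fps (\<lambda>m. Abs_fps (\<lambda>n. \<Sum>k\<le>m + n. (F ^ k) $ m $ n / fact k))"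

lemma power_nth_nth_eq_0:
  fixes F :: "'a::field_char_0 fps fps"
  assumes "F $ 0 $ 0 = 0" "m + n < k"
  shows "(F ^ k) $ m $ n = 0"
  using assms(2)
proof (induction k arbitrary: m n)
  case 0
  then show ?case by simp
next
  case (Suc k)
  have "F $ i $ j * (F ^ k) $ (m - i) $ (n - j) = 0" if "i \<le> m" "j \<le> n" for i j
  proof (cases "i = 0 \<and> j = 0")
    case True
    then show ?thesis using assms(1) by simp
  next
    case False
    then have "(m - i) + (n - j) < k" using Suc.prems that by linarith
    then show ?thesis by (simp add: Suc.IH)
  qed
  then show ?case
    by (auto simp: fps_mult_nth fps_sum_nth intro!: sum.neutral)
qed

lemma exp2_nth_nth:
  fixes F :: "'a::field_char_0 fps fps"
  assumes "F $ 0 $ 0 = 0" "m + n \<le> N"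
  shows "exp2 F $ m $ n = (\<Sum>k\<le>N. (F ^ k) $ m $ n / fact k)"
  unfolding exp2_def fps_nth_Abs_fps
  by (rule sum.mono_neutral_left) (use assms in \<open>auto simp: power_nth_nth_eq_0\<close>)

text \<open>
  The substitution \<open>t := x\<close>, which sends \<open>t\<^sup>m x\<^sup>n\<close> to \<open>x\<^bsup>m+n\<^esup>\<close>.
\<close>

definition subst_t_x :: "'a::field_char_0 fps fps \<Rightarrow> 'a fps" where
  "subst_t_x F = Abs_fps (\<lambda>N. \<Sum>m\<le>N. F $ m $ (N - m))"

text \<open>
  The formal integral of \<open>F\<close> in \<open>t\<close> from \<open>0\<close> to \<open>x\<close>: the antiderivative of \<open>F\<close> in \<open>t\<close> that vanishes
  at \<open>t = 0\<close>, evaluated at \<open>t = x\<close>. The scalars \<open>inverse (of_nat m)\<close> in \<open>fps_integral0\<close> are taken among the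
  power series in \<open>x\<close>, where they are the constants \<open>1 / m\<close>.
\<close>

definition integral_t_0_x :: "'a::field_char_0 fps fps \<Rightarrow> 'a fps" where
  "integral_t_0_x F = subst_t_x (fps_integral0 F)"

end

theory Submission
  imports Defs
begin

text \<open>
  The letter at position \<open>i\<close> of a restricted growth sequence is at most \<open>i\<close>, and once some letter
  falls behind its position, all later ones do. Hence the fixed points form an initial segment:
  a sequence has at least \<open>m\<close> of them iff it begins with \<open>1 2 \<dots> m\<close>. Since
  \<open>q\<^sup>F = 1 + (q - 1) (1 + q + \<dots> + q\<^bsup>F-1\<^esup>)\<close>, the sum over all sequences of length \<open>n\<close> is
  \<open>W 0 n + (q - 1) \<Sum>\<^sub>m q\<^bsup>m-1\<^esup> W m (n - m)\<close> with \<open>m\<close> from 1 to \<open>n\<close>, where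
  \<open>W m l = continuation_sum y m l\<close> sums \<open>y\<^bsup>max\<^esup>\<close> over the ways to append \<open>l\<close> letters to a prefix
  with maximum \<open>m\<close>.

  Appending either repeats one of \<open>m\<close> old letters or introduces letter \<open>m + 1\<close>, so
  \<open>W m (l + 1) = m W m l + W (m + 1) l\<close>, and the exponential generating function of \<open>W m\<close> in \<open>l\<close> is
  \<open>g\<^sub>m(x) = (y e\<^sup>x)\<^sup>m e\<^bsup>y(e^x-1)\<^esup>\<close> (\<open>continuation_sum_egf\<close>). The case \<open>m = 0\<close> is the first summand of
  the formula. For the second, the beta integral
  \<open>\<integral> t\<^sup>k (x-t)\<^sup>l dt = k! l! / (k+l+1)! x\<^bsup>k+l+1\<^esup>\<close> over \<open>[0, x]\<close> turns \<open>\<Sum>\<^sub>n W (k+1) (n-k-1) x\<^sup>n/n!\<close> into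
  \<open>\<integral> t\<^sup>k/k! g\<^bsub>k+1\<^esub>(x-t) dt\<close> (\<open>integral_t_0_x_convolution\<close>), and
  \<open>\<Sum>\<^sub>k (q t)\<^sup>k/k! g\<^bsub>k+1\<^esub>(x-t) = y e\<^bsup>x-t\<^esup> e\<^bsup>y(e^(x-t)-1)\<^esup> e\<^bsup>qty e^(x-t)\<^esup>\<close>
  is, up to the factor \<open>q - 1\<close>, the integrand. That this product of three exponentials is the single \<open>exp2\<close> of the sum
  (\<open>integrand_eq\<close>) rests on two facts: \<open>exp2\<close> is multiplicative, and the substitution of
  \<open>x - t\<close> for \<open>x\<close> is a ring homomorphism that commutes with exponentials. In each
  case the two sides agree at \<open>t = 0\<close> and their \<open>t\<close>-derivatives satisfy the same linear relations,
  which determine a series from its value at \<open>t = 0\<close>.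
\<close>

section \<open>Continuations of restricted growth sequences\<close>

text \<open>
  The \<open>l\<close>-letter words that may follow a prefix with maximum \<open>m\<close>; only \<open>m\<close> matters about
  the prefix, and \<open>m = 0\<close> encodes the empty prefix.
\<close>

fun continuations :: "nat \<Rightarrow> nat \<Rightarrow> nat list set" where
  "continuations m 0 = {[]}"
| "continuations m (Suc l) = (\<Union>a\<in>{1..Suc m}. (#) a ` continuations (max m a) l)"

lemma finite_continuations [simp]: "finite (continuations m l)"
  by (induction m l rule: continuations.induct) auto

lemma sum_continuations_Suc:
  "(\<Sum>\<pi>\<in>continuations m (Suc l). f \<pi>) =
     (\<Sum>a\<in>{1..m}. \<Sum>\<pi>\<in>continuations m l. f (a # \<pi>)) +
     (\<Sum>\<pi>\<in>continuations (Suc m) l. f (Suc m # \<pi>))"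
proof -
  have "(\<Sum>\<pi>\<in>continuations m (Suc l). f \<pi>) =
      (\<Sum>a\<in>{1..Suc m}. \<Sum>\<pi>\<in>(#) a ` continuations (max m a) l. f \<pi>)"
    unfolding continuations.simps by (rule sum.UNION_disjoint) auto
  also have "\<dots> = (\<Sum>a\<in>{1..Suc m}. \<Sum>\<pi>\<in>continuations (max m a) l. f (a # \<pi>))"
    by (simp add: sum.reindex)
  also have "\<dots> = (\<Sum>a\<in>{1..m}. \<Sum>\<pi>\<in>continuations (max m a) l. f (a # \<pi>)) +
     (\<Sum>\<pi>\<in>continuations (Suc m) l. f (Suc m # \<pi>))"
    by (simp add: max_def)
  also have "(\<Sum>a\<in>{1..m}. \<Sum>\<pi>\<in>continuations (max m a) l. f (a # \<pi>)) =
      (\<Sum>a\<in>{1..m}. \<Sum>\<pi>\<in>continuations m l. f (a # \<pi>))"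
    by (intro sum.cong) (auto simp: max_def)
  finally show ?thesis .
qed

text \<open>The non-recursive description, in the form in which restricted growth is defined.\<close>

lemma mem_continuations_iff:
  "\<pi> \<in> continuations m l \<longleftrightarrow>
     length \<pi> = l \<and>
     (\<forall>j<l. 0 < \<pi> ! j \<and> \<pi> ! j \<le> Suc (Max (insert m (set (take j \<pi>)))))"
proof (induction m l arbitrary: \<pi> rule: continuations.induct)
  case (1 m)
  then show ?case by simp
next
  case (2 m l)
  show ?case
  proof (cases \<pi>)
    case Nil
    then show ?thesis by auto
  next
    case (Cons a \<rho>)
    have Max_eq: "Max (insert (max m a) A) = Max (insert m (insert a A))" if "finite A" for A
      using that by (cases "A = {}") (auto simp: max.assoc)
    have "\<pi> \<in> continuations m (Suc l) \<longleftrightarrow>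
        0 < a \<and> a \<le> Suc m \<and> \<rho> \<in> continuations (max m a) l"
      by (auto simp: Cons)
    also have "\<dots> \<longleftrightarrow> length \<rho> = l \<and> (0 < a \<and> a \<le> Suc m) \<and>
        (\<forall>j<l. 0 < \<rho> ! j \<and> \<rho> ! j \<le> Suc (Max (insert m (insert a (set (take j \<rho>))))))"
      using 2 by (cases "a \<in> {1..Suc m}") (auto simp: Max_eq)
    finally show ?thesis
      by (simp add: Cons All_less_Suc2)
  qed
qed

lemma continuations_nth_le:
  assumes "\<pi> \<in> continuations m l" "j < l"
  shows "\<pi> ! j \<le> Suc (m + j)"
  using assms
proof (induction m l arbitrary: \<pi> j rule: continuations.induct)
  case (2 m l)
  then obtain a \<rho> where a: "\<pi> = a # \<rho>" "a \<in> {1..Suc m}" "\<rho> \<in> continuations (max m a) l"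
    by auto
  show ?case
  proof (cases j)
    case 0
    then show ?thesis using a by simp
  next
    case (Suc i)
    have "\<rho> ! i \<le> Suc (max m a + i)"
      using 2 a Suc by auto
    then show ?thesis using a Suc by (auto simp: max_def split: if_splits)
  qed
qed simp

text \<open>
  Inserting 0 leaves the maximum of a nonempty sequence alone and gives the empty one its
  conventional maximum 0; the same device forces the first letter to be 1.
\<close>

lemma RGS_eq_continuations:
  "RGS n k = {\<pi> \<in> continuations 0 n. Max (insert 0 (set \<pi>)) = k}"
proof (cases "n = 0")
  case True
  then show ?thesis by (auto simp: RGS_def)
next
  case False
  have "restricted_growth \<pi> \<longleftrightarrow> \<pi> \<in> continuations 0 n" if len: "length \<pi> = n" for \<pi>
  proof -
    have "\<pi> \<noteq> []" using len False by auto
    have "(\<forall>a\<in>set \<pi>. 0 < a) \<longleftrightarrow> (\<forall>j<n. 0 < \<pi> ! j)"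
      using len by (auto simp: all_set_conv_all_nth)
    moreover have "Max (insert 0 (set (take j \<pi>))) = Max (set (take j \<pi>))" if "1 \<le> j" for j
      using that \<open>\<pi> \<noteq> []\<close> by (simp add: Max_insert)
    moreover have "0 < a \<and> a \<le> Suc 0 \<longleftrightarrow> a = 1" for a :: nat
      by auto
    moreover have "(\<forall>j<n. R j) \<longleftrightarrow> R 0 \<and> (\<forall>j. 1 \<le> j \<and> j < n \<longrightarrow> R j)" for R
      using False by (metis One_nat_def Suc_leI neq0_conv)
    ultimately show ?thesis
      unfolding mem_continuations_iff restricted_growth_def all_conj_distrib
      using len False \<open>\<pi> \<noteq> []\<close>
      by (auto simp: imp_conjR all_conj_distrib cong: conj_cong)
  qed
  moreover have "Max (insert 0 (set \<pi>)) = Max (set \<pi>)" if "length \<pi> = n" for \<pi> :: "nat list"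
    using that False by (cases "\<pi> = []") auto
  ultimately show ?thesis
    using False by (auto simp: RGS_def mem_continuations_iff)
qed

definition continuation_sum :: "'a::field_char_0 \<Rightarrow> nat \<Rightarrow> nat \<Rightarrow> 'a" where
  "continuation_sum y m l = (\<Sum>\<pi>\<in>continuations m l. y ^ Max (insert m (set \<pi>)))"

lemma Max_insert_Cons:
  fixes a m :: nat
  shows "a \<le> m \<Longrightarrow> Max (insert m (set (a # \<pi>))) = Max (insert m (set \<pi>))"
    and "Max (insert m (set (Suc m # \<pi>))) = Max (insert (Suc m) (set \<pi>))"
  by (cases "\<pi> = []"; auto simp: max_def)+

lemma continuation_sum_0 [simp]: "continuation_sum y m 0 = y ^ m"
  by (simp add: continuation_sum_def)

lemma continuation_sum_Suc:
  "continuation_sum y m (Suc l) =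
     of_nat m * continuation_sum y m l + continuation_sum y (Suc m) l"
  unfolding continuation_sum_def sum_continuations_Suc
  by (simp add: Max_insert_Cons del: list.set Max_insert)

section \<open>Fixed points\<close>

text \<open>The fixed points that \<open>\<pi>\<close> contributes when it is placed after a prefix of length \<open>m\<close>.\<close>

definition fixed_from :: "nat \<Rightarrow> nat list \<Rightarrow> nat" where
  "fixed_from m \<pi> = card {i. i < length \<pi> \<and> \<pi> ! i = Suc (m + i)}"

lemma num_fixed_points_eq: "num_fixed_points \<pi> = fixed_from 0 \<pi>"
proof -
  have "{i \<in> {1..length \<pi>}. \<pi> ! (i - 1) = i} = Suc ` {i. i < length \<pi> \<and> \<pi> ! i = Suc (0 + i)}"
  proof (intro set_eqI iffI)
    fix i assume "i \<in> {i \<in> {1..length \<pi>}. \<pi> ! (i - 1) = i}"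
    then show "i \<in> Suc ` {i. i < length \<pi> \<and> \<pi> ! i = Suc (0 + i)}"
      by (cases i) auto
  qed auto
  then show ?thesis
    by (simp add: num_fixed_points_def fixed_from_def card_image)
qed

lemma fixed_from_new_letter: "fixed_from m (Suc m # \<pi>) = Suc (fixed_from (Suc m) \<pi>)"
proof -
  have "{i. i < length (Suc m # \<pi>) \<and> (Suc m # \<pi>) ! i = Suc (m + i)} =
      insert 0 (Suc ` {i. i < length \<pi> \<and> \<pi> ! i = Suc (Suc m + i)})" (is "?A = ?B")
  proof (intro set_eqI)
    show "i \<in> ?A \<longleftrightarrow> i \<in> ?B" for i by (cases i) auto
  qed
  then show ?thesis
    by (simp add: fixed_from_def card_image)
qed

text \<open>
  After a prefix of length \<open>m\<close> and maximum \<open>m\<close>, an old letter ends the run of fixed points for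
  good: the maximum now lags behind the position, and it can only grow by one per letter.
\<close>

lemma fixed_from_old_letter:
  assumes "a \<le> m" "\<pi> \<in> continuations m l"
  shows "fixed_from m (a # \<pi>) = 0"
proof -
  have "(a # \<pi>) ! i \<noteq> Suc (m + i)" if "i < length (a # \<pi>)" for i
  proof (cases i)
    case (Suc j)
    then have "\<pi> ! j \<le> Suc (m + j)"
      using assms(2) that by (intro continuations_nth_le) (auto simp: mem_continuations_iff)
    then show ?thesis using Suc by simp
  qed (use assms(1) in simp)
  then show ?thesis by (auto simp: fixed_from_def)
qed

text \<open>
  Here \<open>m\<close> is both length and maximum of the prefix, so a next letter is a fixed point iff it is new.
  The right-hand side is \<open>q\<^sup>F = 1 + (q - 1) \<Sum>\<^sub>j q\<^sup>j\<close>, with \<open>j\<close> ranging below \<open>F\<close>, summed over the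
  continuations: the \<open>j\<close>-th term collects those that begin with at least \<open>j + 1\<close> fixed points.
\<close>

lemma sum_fixed_from:
  fixes y q :: "'a::field_char_0"
  shows "(\<Sum>\<pi>\<in>continuations m l. q ^ fixed_from m \<pi> * y ^ Max (insert m (set \<pi>))) =
     continuation_sum y m l +
     (q - 1) * (\<Sum>j<l. q ^ j * continuation_sum y (Suc (m + j)) (l - Suc j))"
proof (induction l arbitrary: m)
  case 0
  then show ?case by (simp add: continuation_sum_def fixed_from_def)
next
  case (Suc l)
  define V where "V m l = (\<Sum>\<pi>\<in>continuations m l. q ^ fixed_from m \<pi> * y ^ Max (insert m (set \<pi>)))"
    for m l
  define T where "T = (\<Sum>j<l. q ^ j * continuation_sum y (Suc (Suc m + j)) (l - Suc j))"
  have "V m (Suc l) = of_nat m * continuation_sum y m l + q * V (Suc m) l"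
    unfolding V_def sum_continuations_Suc continuation_sum_def
    by (simp add: Max_insert_Cons fixed_from_old_letter fixed_from_new_letter sum_distrib_left
        mult_ac del: list.set Max_insert)
  also have "V (Suc m) l = continuation_sum y (Suc m) l + (q - 1) * T"
    unfolding V_def T_def by (rule Suc.IH)
  finally have "V m (Suc l) =
      continuation_sum y m (Suc l) + (q - 1) * (continuation_sum y (Suc m) l + q * T)"
    by (simp add: continuation_sum_Suc algebra_simps)
  also have "continuation_sum y (Suc m) l + q * T =
      (\<Sum>j<Suc l. q ^ j * continuation_sum y (Suc (m + j)) (Suc l - Suc j))"
    by (subst sum.lessThan_Suc_shift) (simp add: T_def sum_distrib_left mult_ac)
  finally show ?case by (simp add: V_def)
qed

lemma RGS_egf_nth:
  fixes y q :: "'a::field_char_0"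
  shows "RGS_egf y q $ n =
     (continuation_sum y 0 n +
      (q - 1) * (\<Sum>j<n. q ^ j * continuation_sum y (Suc j) (n - Suc j))) / fact n"
proof -
  have "(\<Sum>k\<le>n. \<Sum>\<pi>\<in>RGS n k. q ^ num_fixed_points \<pi> * y ^ k) =
      (\<Sum>k\<le>n. \<Sum>\<pi>\<in>{\<pi> \<in> continuations 0 n. Max (insert 0 (set \<pi>)) = k}.
         q ^ fixed_from 0 \<pi> * y ^ Max (insert 0 (set \<pi>)))"
    by (intro sum.cong) (auto simp: RGS_eq_continuations num_fixed_points_eq)
  also have "\<dots> = (\<Sum>\<pi>\<in>continuations 0 n. q ^ fixed_from 0 \<pi> * y ^ Max (insert 0 (set \<pi>)))"
  proof (rule sum.group)
    show "(\<lambda>\<pi>. Max (insert 0 (set \<pi>))) ` continuations 0 n \<subseteq> {..n}"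
      using continuations_nth_le[of _ 0 n]
      by (fastforce simp: mem_continuations_iff in_set_conv_nth)
  qed auto
  finally show ?thesis
    by (simp add: RGS_egf_def sum_fixed_from)
qed

section \<open>The generating function of continuations\<close>

text \<open>The generating function \<open>e\<^bsup>y(e^x-1)\<^esup>\<close> of the Touchard polynomials.\<close>

definition touchard_egf :: "'a::field_char_0 \<Rightarrow> 'a fps" where
  "touchard_egf y = fps_exp 1 oo (fps_const y * (fps_exp 1 - 1))"

lemma fps_deriv_touchard_egf:
  "fps_deriv (touchard_egf y) = fps_const y * fps_exp 1 * touchard_egf y"
  unfolding touchard_egf_def by (subst fps_compose_deriv) (simp_all add: mult_ac)

text \<open>
  With \<open>u = y e\<^sup>x\<close>, both \<open>u' = u\<close> and \<open>B' = u B\<close> for the Touchard series \<open>B\<close>, so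
  \<open>(u\<^sup>m B)' = m u\<^sup>m B + u\<^bsup>m+1\<^esup> B\<close>: the recurrence of \<open>continuation_sum_Suc\<close>.
\<close>

lemma continuation_sum_egf:
  "((fps_const y * fps_exp 1) ^ m * touchard_egf y) $ l = continuation_sum y m l / fact l"
proof (induction l arbitrary: m)
  case 0
  then show ?case by (simp add: touchard_egf_def fps_nth_power_0)
next
  case (Suc l)
  let ?u = "fps_const y * fps_exp (1::'a)"
  let ?h = "\<lambda>m. ?u ^ m * touchard_egf y"
  have "fps_deriv ?u = ?u" by simp
  have "fps_deriv (?h m) = of_nat m * ?h m + ?h (Suc m)"
  proof (cases m)
    case 0
    then show ?thesis by (simp add: fps_deriv_touchard_egf)
  next
    case (Suc j)
    show ?thesis
      unfolding Suc fps_deriv_mult fps_deriv_power \<open>fps_deriv ?u = ?u\<close> fps_deriv_touchard_egf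
      by (simp add: algebra_simps fps_of_nat flip: of_nat_Suc fps_of_nat)
  qed
  then have "of_nat (Suc l) * ?h m $ Suc l = of_nat m * ?h m $ l + ?h (Suc m) $ l"
    by (metis fps_add_nth fps_deriv_nth fps_mult_of_nat_nth(1) Suc_eq_plus1)
  also have "\<dots> = continuation_sum y m (Suc l) / fact l"
    unfolding Suc.IH continuation_sum_Suc by (simp add: add_divide_distrib)
  finally show ?case
    by (simp add: field_simps del: of_nat_Suc)
qed

section \<open>Exponentials of bivariate series\<close>

text \<open>
  The coefficients form an integral domain rather than a field so that this applies to series
  in \<open>t\<close> over series in \<open>x\<close> as well as to series in \<open>x\<close> alone. In characteristic 0, a
  series is determined by its derivative and its constant term.
\<close>

lemma fps_deriv_eq_mult_unique:
  fixes A P R :: "'b::idom fps"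
  assumes "CHAR('b) = 0"
    and "fps_deriv P = A * P" "fps_deriv R = A * R" "P $ 0 = R $ 0"
  shows "P = R"
proof (rule fps_ext)
  fix n
  show "P $ n = R $ n"
  proof (induction n rule: less_induct)
    case (less n)
    show ?case
    proof (cases n)
      case (Suc m)
      have "fps_deriv P $ m = fps_deriv R $ m"
        unfolding assms(2,3) fps_mult_nth using Suc less by (intro sum.cong) auto
      then have "of_nat (Suc m) * P $ Suc m = of_nat (Suc m) * R $ Suc m" by simp
      moreover have "(of_nat (Suc m) :: 'b) \<noteq> 0"
        using assms(1) by (simp add: of_nat_eq_0_iff_char_dvd del: of_nat_Suc)
      ultimately show ?thesis using Suc by (simp del: of_nat_Suc)
    qed (use assms(4) in simp)
  qed
qed

text \<open>
  This licenses termwise treatment of \<open>A * exp2 F\<close>: up to total degree \<open>N\<close>, the exponential is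
  the finite sum of \<open>F\<^sup>k / k!\<close> for \<open>k \<le> N\<close>.
\<close>

lemma mult_exp2_nth_nth:
  fixes A F :: "'a::field_char_0 fps fps"
  assumes "F $ 0 $ 0 = 0" "m + n \<le> N"
  shows "(A * exp2 F) $ m $ n = (\<Sum>k\<le>N. (A * F ^ k) $ m $ n / fact k)"
proof -
  have "(A * exp2 F) $ m $ n =
      (\<Sum>i=0..m. \<Sum>j=0..n. A $ i $ j * (\<Sum>k\<le>N. (F ^ k) $ (m - i) $ (n - j) / fact k))"
    unfolding fps_mult_nth fps_sum_nth
    using assms by (intro sum.cong refl) (simp add: exp2_nth_nth)
  also have "\<dots> = (\<Sum>i=0..m. \<Sum>j=0..n. \<Sum>k\<le>N. A $ i $ j * (F ^ k) $ (m - i) $ (n - j) / fact k)"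
    by (simp add: sum_distrib_left)
  also have "\<dots> = (\<Sum>k\<le>N. \<Sum>i=0..m. \<Sum>j=0..n. A $ i $ j * (F ^ k) $ (m - i) $ (n - j) / fact k)"
    by (simp only: sum.swap[of _ "{..N}"])
  finally show ?thesis
    by (simp add: fps_mult_nth fps_sum_nth sum_divide_distrib)
qed

lemma fps_deriv_exp2:
  fixes F :: "'a::field_char_0 fps fps"
  assumes F: "F $ 0 $ 0 = 0"
  shows "fps_deriv (exp2 F) = fps_deriv F * exp2 F"
proof (intro fps_ext)
  fix m n
  have "fps_deriv (exp2 F) $ m $ n = of_nat (Suc m) * exp2 F $ Suc m $ n"
    by (simp del: of_nat_Suc)
  also have "\<dots> = (\<Sum>k\<le>Suc (m + n). of_nat (Suc m) * (F ^ k) $ Suc m $ n / fact k)"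
    using exp2_nth_nth[OF F, of "Suc m" n "Suc (m + n)"]
    by (simp add: sum_distrib_left del: sum.atMost_Suc of_nat_Suc)
  also have "\<dots> = (\<Sum>k\<le>Suc (m + n). fps_deriv (F ^ k) $ m $ n / fact k)"
    by (simp del: of_nat_Suc)
  also have "\<dots> = (\<Sum>k\<le>m + n. fps_deriv (F ^ Suc k) $ m $ n / fact (Suc k))"
    by (subst sum.atMost_Suc_shift) simp
  also have "\<dots> = (\<Sum>k\<le>m + n. (fps_deriv F * F ^ k) $ m $ n / fact k)"
  proof (intro sum.cong refl)
    fix k
    have "fps_deriv (F ^ Suc k) = of_nat (Suc k) * (fps_deriv F * F ^ k)"
      by (simp add: fps_deriv_power' mult_ac del: power_Suc of_nat_Suc)
    then show "fps_deriv (F ^ Suc k) $ m $ n / fact (Suc k) = (fps_deriv F * F ^ k) $ m $ n / fact k"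
      by (simp del: of_nat_Suc power_Suc)
  qed
  also have "\<dots> = (fps_deriv F * exp2 F) $ m $ n"
    by (rule mult_exp2_nth_nth[OF F, symmetric]) simp
  finally show "fps_deriv (exp2 F) $ m $ n = (fps_deriv F * exp2 F) $ m $ n" .
qed

lemma exp2_nth_0:
  fixes F :: "'a::field_char_0 fps fps"
  shows "exp2 F $ 0 = fps_exp 1 oo F $ 0"
  by (rule fps_ext) (simp add: exp2_def fps_compose_nth fps_nth_power_0 atMost_atLeast0)

lemma fps_exp_compose_add:
  fixes f g :: "'a::field_char_0 fps"
  assumes "f $ 0 = 0" "g $ 0 = 0"
  shows "fps_exp 1 oo (f + g) = (fps_exp 1 oo f) * (fps_exp 1 oo g)"
  by (rule fps_deriv_eq_mult_unique[where A = "fps_deriv f + fps_deriv g"])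
    (use assms in \<open>simp_all add: fps_compose_deriv algebra_simps\<close>)

lemma exp2_add:
  fixes F G :: "'a::field_char_0 fps fps"
  assumes "F $ 0 $ 0 = 0" "G $ 0 $ 0 = 0"
  shows "exp2 (F + G) = exp2 F * exp2 G"
proof (rule fps_deriv_eq_mult_unique)
  show "fps_deriv (exp2 (F + G)) = (fps_deriv F + fps_deriv G) * exp2 (F + G)"
    using assms by (simp add: fps_deriv_exp2)
  show "fps_deriv (exp2 F * exp2 G) = (fps_deriv F + fps_deriv G) * (exp2 F * exp2 G)"
    using assms by (simp add: fps_deriv_exp2 algebra_simps)
  show "exp2 (F + G) $ 0 = (exp2 F * exp2 G) $ 0"
    using assms by (simp add: exp2_nth_0 fps_exp_compose_add)
qed simp

section \<open>Substituting \<open>x - t\<close> for \<open>x\<close>\<close>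

text \<open>
  The series \<open>f(x - t)\<close>, with \<open>(x - t)\<^sup>N\<close> expanded by the binomial theorem; \<open>t\<^sup>m x\<^sup>n\<close>
  arises from \<open>N = m + n\<close> only.
\<close>

definition subst_x_minus_t :: "'a::field_char_0 fps \<Rightarrow> 'a fps fps" where
  "subst_x_minus_t f =
     Abs_fps (\<lambda>m. Abs_fps (\<lambda>n. (-1) ^ m * of_nat (m + n choose m) * f $ (m + n)))"

lemma subst_x_minus_t_nth_0 [simp]: "subst_x_minus_t f $ 0 = f"
  by (rule fps_ext) (simp add: subst_x_minus_t_def)

lemma subst_x_minus_t_add: "subst_x_minus_t (f + g) = subst_x_minus_t f + subst_x_minus_t g"
  by (intro fps_ext) (simp add: subst_x_minus_t_def algebra_simps)

lemma subst_x_minus_t_diff: "subst_x_minus_t (f - g) = subst_x_minus_t f - subst_x_minus_t g"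
  by (intro fps_ext) (simp add: subst_x_minus_t_def algebra_simps)

lemma fps_deriv_subst_x_minus_t:
  "fps_deriv (subst_x_minus_t f) = - subst_x_minus_t (fps_deriv f)"
proof (intro fps_ext)
  fix m n
  have "of_nat (Suc m) * of_nat (Suc m + n choose Suc m) =
      (of_nat (m + n choose m) * of_nat (Suc (m + n)) :: 'a)"
    using Suc_times_binomial_eq[of "m + n" m]
    by (simp flip: of_nat_mult add: mult_ac del: of_nat_Suc binomial_Suc_Suc)
  then show "fps_deriv (subst_x_minus_t f) $ m $ n = (- subst_x_minus_t (fps_deriv f)) $ m $ n"
    by (simp add: subst_x_minus_t_def mult_ac del: of_nat_Suc)
qed

text \<open>
  Both sides agree at \<open>t = 0\<close>, and by the product rule their \<open>t\<close>-derivatives are minus the sum of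
  the corresponding sides for \<open>f' g\<close> and for \<open>f g'\<close>. Equality thus passes from the coefficient of
  \<open>t\<^sup>m\<close>, for all pairs of series at once, to that of \<open>t\<^bsup>m+1\<^esup>\<close>.
\<close>

lemma subst_x_minus_t_mult:
  fixes f g :: "'a::field_char_0 fps"
  shows "subst_x_minus_t (f * g) = subst_x_minus_t f * subst_x_minus_t g"
proof (rule fps_ext)
  fix m
  show "subst_x_minus_t (f * g) $ m = (subst_x_minus_t f * subst_x_minus_t g) $ m"
  proof (induction m arbitrary: f g)
    case 0
    then show ?case by simp
  next
    case (Suc m)
    have "fps_deriv (subst_x_minus_t (f * g)) $ m =
        fps_deriv (subst_x_minus_t f * subst_x_minus_t g) $ m"
      by (simp add: fps_deriv_subst_x_minus_t subst_x_minus_t_add Suc.IH)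
    then have "of_nat (Suc m) * subst_x_minus_t (f * g) $ Suc m =
        of_nat (Suc m) * (subst_x_minus_t f * subst_x_minus_t g) $ Suc m"
      by (simp del: of_nat_Suc fps_deriv_mult)
    moreover have "(of_nat (Suc m) :: 'a fps) \<noteq> 0"
      by (simp add: of_nat_eq_0_iff_char_dvd del: of_nat_Suc)
    ultimately show ?case
      by (simp del: of_nat_Suc)
  qed
qed

lemma subst_x_minus_t_const [simp]: "subst_x_minus_t (fps_const c) = const2 c"
  by (intro fps_ext) (auto simp: subst_x_minus_t_def fps_eq_iff)

lemma subst_x_minus_t_power: "subst_x_minus_t (f ^ k) = subst_x_minus_t f ^ k"
proof (induction k)
  case 0
  show ?case using subst_x_minus_t_const[of 1] by simp
qed (simp add: subst_x_minus_t_mult)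

lemma subst_x_minus_t_X: "subst_x_minus_t fps_X = var_x - var_t"
proof (intro fps_ext)
  fix m n
  show "subst_x_minus_t fps_X $ m $ n = (var_x - var_t) $ m $ n"
    by (cases m; cases "m - 1") (auto simp: subst_x_minus_t_def)
qed

lemma exp2_subst_x_minus_t:
  assumes "f $ 0 = 0"
  shows "exp2 (subst_x_minus_t f) = subst_x_minus_t (fps_exp 1 oo f)"
proof (rule fps_deriv_eq_mult_unique)
  show "fps_deriv (exp2 (subst_x_minus_t f)) =
      - subst_x_minus_t (fps_deriv f) * exp2 (subst_x_minus_t f)"
    using assms by (simp add: fps_deriv_exp2 fps_deriv_subst_x_minus_t)
  show "fps_deriv (subst_x_minus_t (fps_exp 1 oo f)) =
      - subst_x_minus_t (fps_deriv f) * subst_x_minus_t (fps_exp 1 oo f)"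
    using assms by (simp add: fps_deriv_subst_x_minus_t fps_compose_deriv subst_x_minus_t_mult mult_ac)
qed (simp_all add: exp2_nth_0)

section \<open>The formal integral and convolution\<close>

lemma integral_t_0_x_nth:
  fixes F :: "'a::field_char_0 fps fps"
  shows "integral_t_0_x F $ N = (\<Sum>m<N. F $ m $ (N - Suc m) / of_nat (Suc m))"
proof -
  have inv: "inverse (of_nat k :: 'a fps) = fps_const (1 / of_nat k)" for k
    by (metis fps_const_inverse fps_of_nat inverse_eq_divide)
  have "integral_t_0_x F $ N = (\<Sum>m\<in>insert 0 (Suc ` {..<N}). fps_integral0 F $ m $ (N - m))"
    by (simp add: integral_t_0_x_def subst_t_x_def lessThan_Suc_eq_insert_0
        flip: lessThan_Suc_atMost)
  also have "\<dots> = (\<Sum>m<N. F $ m $ (N - Suc m) / of_nat (Suc m))"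
    by (subst sum.insert) (auto simp: sum.reindex fps_integral_def inv simp del: of_nat_Suc)
  finally show ?thesis .
qed

text \<open>
  The beta integral of \<open>t\<^sup>k (1 - t)\<^sup>l\<close> over \<open>[0, 1]\<close>, expanded in powers of \<open>t\<close>. Pascal's rule in the
  proof is \<open>t\<^sup>k (1 - t)\<^bsup>l+1\<^esup> = t\<^sup>k (1 - t)\<^sup>l - t\<^bsup>k+1\<^esup> (1 - t)\<^sup>l\<close>.
\<close>

lemma alternating_binomial_beta_sum:
  "(\<Sum>j\<le>l. (-1) ^ j * of_nat (l choose j) / of_nat (Suc (k + j))) =
     (fact k * fact l / fact (Suc (k + l)) :: 'a::field_char_0)"
proof (induction l arbitrary: k)
  case 0
  then show ?case by simp
next
  case (Suc l)
  let ?c = "\<lambda>k l j. (-1) ^ j * of_nat (l choose j) / of_nat (Suc (k + j)) :: 'a"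
  have "(\<Sum>j\<le>Suc l. ?c k (Suc l) j) =
      ?c k (Suc l) 0 + (\<Sum>j\<le>l. ?c k l (Suc j)) - (\<Sum>j\<le>l. ?c (Suc k) l j)"
    by (subst sum.atMost_Suc_shift)
      (simp add: add_divide_distrib diff_divide_distrib distrib_left sum.distrib sum_subtractf sum_negf)
  also have "?c k (Suc l) 0 + (\<Sum>j\<le>l. ?c k l (Suc j)) = (\<Sum>j\<le>Suc l. ?c k l j)"
    by (subst sum.atMost_Suc_shift) simp
  also have "\<dots> = (\<Sum>j\<le>l. ?c k l j)"
    by simp
  also have "(\<Sum>j\<le>l. ?c k l j) - (\<Sum>j\<le>l. ?c (Suc k) l j) =
      fact k * fact l / fact (Suc (k + l)) - fact (Suc k) * fact l / fact (Suc (Suc (k + l)))"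
    using Suc.IH[of k] Suc.IH[of "Suc k"] by simp
  also have "\<dots> = fact k * fact (Suc l) / fact (Suc (k + Suc l))"
  proof -
    define M where "M = (fact (Suc (k + l)) :: 'a)"
    define c where "c = (of_nat (Suc (Suc (k + l))) :: 'a)"
    have "M \<noteq> 0" "c \<noteq> 0"
      by (simp_all add: M_def c_def del: of_nat_Suc fact_Suc)
    have "fact k * fact l / M - of_nat (Suc k) * fact k * fact l / (c * M) =
        (c - of_nat (Suc k)) * (fact k * fact l) / (c * M)"
      using \<open>M \<noteq> 0\<close> \<open>c \<noteq> 0\<close> by (simp add: divide_simps algebra_simps)
    also have "c - of_nat (Suc k) = of_nat (Suc l)"
      by (simp add: c_def)
    finally show ?thesis
      unfolding add_Suc_right fact_Suc[of "Suc (k + l)"] fact_Suc[of k] fact_Suc[of l]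
        M_def[symmetric] c_def[symmetric]
      by (simp add: mult_ac del: of_nat_Suc)
  qed
  finally show ?case .
qed

text \<open>
  On exponential coefficients, convolution with \<open>t\<^sup>k / k!\<close> is a shift by \<open>k + 1\<close>: this is
  \<open>(k+1)\<close>-fold integration.
\<close>

lemma integral_t_0_x_convolution:
  fixes f :: "'a::field_char_0 fps"
  shows "integral_t_0_x (var_t ^ k * subst_x_minus_t f) $ N =
     (if k < N then fact k * fact (N - Suc k) / fact N * f $ (N - Suc k) else 0)"
proof (cases "k < N")
  case False
  then show ?thesis by (simp add: integral_t_0_x_nth fps_X_power_mult_nth)
next
  case True
  define l where "l = N - Suc k"
  have N: "N = Suc (k + l)" using True by (simp add: l_def)
  let ?G = "\<lambda>m. (var_t ^ k * subst_x_minus_t f) $ m $ (N - Suc m) / of_nat (Suc m)"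
  have "integral_t_0_x (var_t ^ k * subst_x_minus_t f) $ N = (\<Sum>m\<in>{k..k+l}. ?G m)"
    unfolding integral_t_0_x_nth
    by (rule sum.mono_neutral_right) (auto simp: N fps_X_power_mult_nth)
  also have "\<dots> = (\<Sum>j\<le>l. ?G (k + j))"
    by (rule sum.reindex_bij_witness[of _ "\<lambda>j. k + j" "\<lambda>m. m - k"]) auto
  also have "\<dots> = (\<Sum>j\<le>l. (-1) ^ j * of_nat (l choose j) / of_nat (Suc (k + j)) * f $ l)"
    by (intro sum.cong refl) (auto simp: N fps_X_power_mult_nth subst_x_minus_t_def)
  also have "\<dots> = fact k * fact l / fact N * f $ l"
    unfolding N alternating_binomial_beta_sum[symmetric] by (simp add: sum_distrib_right)
  finally show ?thesis using True by (simp add: l_def)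
qed

section \<open>The formula\<close>

text \<open>
  The exponent is the sum of \<open>x - t\<close>, of \<open>y (e\<^bsup>x-t\<^esup> - 1)\<close> and of \<open>q t y e\<^bsup>x-t\<^esup>\<close>. The first two are
  functions of \<open>x - t\<close>. The third is divisible by \<open>t\<close> and stays an exponential, whose terms
  supply the powers \<open>t\<^sup>k / k!\<close>.
\<close>

lemma integrand_eq:
  fixes y q :: "'a::field_char_0"
  defines "u \<equiv> fps_const y * fps_exp 1"
  shows "exp2 (var_x - var_t + (1 + const2 q * var_t) * const2 y * exp2 (var_x - var_t) - const2 y) =
    subst_x_minus_t (fps_exp 1 * touchard_egf y) * exp2 (var_t * subst_x_minus_t (fps_const q * u))"
proof -
  have e: "exp2 (var_x - var_t) = subst_x_minus_t (fps_exp 1)"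
    using exp2_subst_x_minus_t[of fps_X] by (simp flip: subst_x_minus_t_X)
  define b where "b = fps_const y * (fps_exp 1 - 1)"
  have b: "subst_x_minus_t b = const2 y * (subst_x_minus_t (fps_exp 1) - 1)"
    using subst_x_minus_t_const[of "1::'a"]
    by (simp add: b_def subst_x_minus_t_mult subst_x_minus_t_diff)
  have "var_x - var_t + (1 + const2 q * var_t) * const2 y * exp2 (var_x - var_t) - const2 y =
      (subst_x_minus_t fps_X + subst_x_minus_t b) + var_t * subst_x_minus_t (fps_const q * u)"
    unfolding e b u_def subst_x_minus_t_X subst_x_minus_t_mult
    by (simp add: algebra_simps)
  moreover have "b $ 0 = 0" by (simp add: b_def)
  ultimately show ?thesis
    by (simp add: exp2_add exp2_subst_x_minus_t subst_x_minus_t_mult touchard_egf_def flip: b_def)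
qed

theorem theorem1:
  fixes y q :: "'a::field_char_0"
  shows "RGS_egf y q =
    (fps_exp 1 oo (fps_const y * (fps_exp 1 - 1))) +
    integral_t_0_x
      (const2 (q - 1) * const2 y *
       exp2 (var_x - var_t + (1 + const2 q * var_t) * const2 y * exp2 (var_x - var_t) - const2 y))"
proof (rule fps_ext)
  fix n
  define u where "u = fps_const y * fps_exp (1::'a)"
  define A where "A = const2 (q - 1) * const2 y * subst_x_minus_t (fps_exp 1 * touchard_egf y)"
  define F where "F = var_t * subst_x_minus_t (fps_const q * u)"
  \<comment> \<open>Each term is a power of \<open>t\<close> times a multiple of \<open>g\<^bsub>k+1\<^esub>(x - t)\<close>; the extra factor \<open>u\<close> is
     the \<open>y e\<^bsup>x-t\<^esup>\<close> in front of the exponential.\<close>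
  have AF: "A * F ^ k =
      var_t ^ k * subst_x_minus_t (fps_const ((q - 1) * q ^ k) * (u ^ Suc k * touchard_egf y))" for k
    unfolding A_def F_def u_def subst_x_minus_t_const[symmetric] subst_x_minus_t_mult[symmetric]
      power_mult_distrib subst_x_minus_t_power[symmetric]
    by (simp add: subst_x_minus_t_mult subst_x_minus_t_power algebra_simps)
  have "integral_t_0_x (A * exp2 F) $ n = (\<Sum>k\<le>n. integral_t_0_x (A * F ^ k) $ n / fact k)"
  proof -
    have "integral_t_0_x (A * exp2 F) $ n =
       (\<Sum>m<n. \<Sum>k\<le>n. (A * F ^ k) $ m $ (n - Suc m) / fact k / of_nat (Suc m))"
      unfolding integral_t_0_x_nth sum_divide_distrib[symmetric]
      by (intro sum.cong arg_cong2[of _ _ _ _ "(/)"] mult_exp2_nth_nth refl) (auto simp: F_def)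
    also have "\<dots> = (\<Sum>k\<le>n. \<Sum>m<n. (A * F ^ k) $ m $ (n - Suc m) / fact k / of_nat (Suc m))"
      by (rule sum.swap)
    finally show ?thesis
      by (simp add: integral_t_0_x_nth sum_divide_distrib mult_ac)
  qed
  \<comment> \<open>The term \<open>k = n\<close> has degree at least \<open>n + 1\<close> after integration.\<close>
  also have "\<dots> = (\<Sum>k<n. integral_t_0_x (A * F ^ k) $ n / fact k)"
    by (rule sum.mono_neutral_right) (auto simp: AF integral_t_0_x_convolution)
  also have "\<dots> = (\<Sum>k<n. (q - 1) * (q ^ k * continuation_sum y (Suc k) (n - Suc k)) / fact n)"
    by (intro sum.cong refl)
      (simp add: AF integral_t_0_x_convolution u_def continuation_sum_egf del: power_Suc)
  finally have "integral_t_0_x (A * exp2 F) $ n =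
      (q - 1) * (\<Sum>k<n. q ^ k * continuation_sum y (Suc k) (n - Suc k)) / fact n"
    by (simp add: sum_distrib_left sum_divide_distrib)
  moreover have "touchard_egf y $ n = continuation_sum y 0 n / fact n"
    using continuation_sum_egf[of y 0 n] by simp
  ultimately show "RGS_egf y q $ n = ((fps_exp 1 oo (fps_const y * (fps_exp 1 - 1))) +
    integral_t_0_x
      (const2 (q - 1) * const2 y *
       exp2 (var_x - var_t + (1 + const2 q * var_t) * const2 y * exp2 (var_x - var_t) - const2 y))) $ n"
    unfolding RGS_egf_nth integrand_eq A_def F_def u_def touchard_egf_def[symmetric]
    by (simp add: add_divide_distrib mult.assoc)
qed

end
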